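(* Let $k\ge 1$ and let $L_i(x)=a_ix+b_i$ and $H_j(x)=c_jx+d_j$ ($1\le i,j\le k$) be linear polynomials with integer coefficients such that $a_i>0$ and $c_j>0$ for all $i,j$, and $$a_id_j\neq b_ic_j\quad\text{for all }1\le i,j\le k.$$ Suppose that for every prime $p$ there is at least one integer $n_p$ such that $p$ divides none of $L_1(n_p),\dots,L_k(n_p)$. Then there exist constants $c>0$ and $x_0$, depending on the polynomials $L_i$ and $H_j$, such that for all $x\ge x_0$ the number of positive integers $n\le x$ satisfying $$\sigma(H_j(n))>\max_{1\le i\le k}\sigma(L_i(n))\quad\text{for all }1\le j\le k$$ is at least $c\,x(\log x)^{-k}$.
   Context: $\sigma(n)=\sum_{d\mid n} d$ denotes the sum of the positive divisors of the positive integer $n$. *)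

theory Defs
  imports Complex_Main "HOL-Computational_Algebra.Primes"
begin

definition divisor_sum :: "nat \<Rightarrow> nat" where
  "divisor_sum n = (\<Sum>d | d dvd n. d)"

end

theory Submission
  imports Defs "HOL-Analysis.Harmonic_Numbers" "HOL-Number_Theory.Cong" "HOL-Real_Asymp.Real_Asymp"
begin

text \<open>
  No sieve is needed: the inequality holds for a positive proportion of all \<open>n\<close>.
  Products \<open>N\<close> of numbers \<open>1 + t W\<close> are coprime to \<open>W\<close> and have arbitrarily large \<open>\<sigma>(N)/N\<close>,
  because the harmonic series diverges. Hence there are pairwise coprime such \<open>N\<^sub>1, \<dots>, N\<^sub>k\<close> with
  product \<open>Q\<close>, and a residue class modulo \<open>Q\<close> on which \<open>N\<^sub>j\<close> divides \<open>H\<^sub>j(n)\<close>. On it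
  \<open>\<sigma>(H\<^sub>j(n))/H\<^sub>j(n)\<close> is at least any prescribed bound, while the nonvanishing of \<open>a\<^sub>i d\<^sub>j - b\<^sub>i c\<^sub>j\<close>
  makes \<open>L\<^sub>i(n)\<close> coprime to \<open>Q\<close>. Since \<open>\<sigma>(m)/m\<close> is the sum of \<open>1/e\<close> over the divisors \<open>e\<close> of \<open>m\<close>,
  the mean of \<open>\<sigma>(L\<^sub>i(n))/L\<^sub>i(n)\<close> over the class is at most \<open>2 a\<^sub>i + o(1)\<close>, independently of \<open>Q\<close>.
  By Markov's inequality all \<open>\<sigma>(L\<^sub>i(n))/L\<^sub>i(n)\<close> are below a fixed bound for half of the class.
\<close>

section \<open>The ratio of the divisor sum to the number, and how to make it large\<close>

lemma divisor_sum_ratio: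
  assumes "n > 0"
  shows "real (divisor_sum n) / real n = (\<Sum>e | e dvd n. 1 / real e)"
proof -
  have "(\<Sum>e | e dvd n. 1 / real e) = (\<Sum>e | e dvd n. real e / real n)"
    by (rule sum.reindex_bij_witness[of _ "\<lambda>e. n div e" "\<lambda>e. n div e"])
      (use assms in \<open>auto elim!: dvdE\<close>)
  then show ?thesis
    by (simp add: divisor_sum_def sum_divide_distrib)
qed

lemma divisor_sum_ratio_mono:
  assumes "N dvd n" "n > 0"
  shows "real (divisor_sum N) / real N \<le> real (divisor_sum n) / real n"
proof -
  have "N > 0"
    using assms by (auto intro: Nat.gr0I)
  moreover have "(\<Sum>e | e dvd N. 1 / real e) \<le> (\<Sum>e | e dvd n. 1 / real e)"
    by (rule sum_mono2) (use assms in \<open>auto intro: dvd_trans\<close>)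
  ultimately show ?thesis
    using assms by (simp add: divisor_sum_ratio)
qed

lemma ex_coprime_divisor_sum_ratio_ge:
  fixes B :: real
  assumes "W > 0"
  shows "\<exists>N > 0. coprime N W \<and> B \<le> real (divisor_sum N) / real N"
proof -
  \<comment> \<open>\<open>1 + t * W\<close> is at most \<open>W * (t + 1)\<close>, so the
    reciprocals of the first \<open>T\<close> factors sum to at least \<open>harm T / W\<close>;
    this has to reach \<open>B\<close>.\<close>
  obtain T where T: "B * real W \<le> harm T"
    using harm_at_top by (metis (no_types, lifting) filterlim_at_top eventually_happens sequentially_bot)
  define g where "g t = 1 + t * W" for t
  define N where "N = (\<Prod>t<T. g t)"
  have "coprime (g t) W" for t
    by (metis g_def gcd_add_mult gcd.commute coprime_iff_gcd_eq_1 coprime_1_right add.commute)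
  then have "coprime N W"
    unfolding N_def by (auto intro: prod_coprime_left)
  moreover have N: "N > 0"
    by (simp add: N_def g_def)
  moreover have "B \<le> real (divisor_sum N) / real N"
  proof -
    have inj: "inj g"
      using assms by (auto simp: inj_def g_def)
    have "B \<le> harm T / real W"
      using T assms by (simp add: field_simps)
    also have "\<dots> = (\<Sum>t<T. 1 / (real W * real (Suc t)))"
      by (simp add: harm_def sum_divide_distrib divide_simps sum.atLeast1_atMost_eq mult.commute)
    also have "\<dots> \<le> (\<Sum>t<T. 1 / real (g t))"
    proof (rule sum_mono)
      fix t
      have "g t \<le> W * Suc t"
        using assms by (simp add: g_def mult.commute)
      then have "real (g t) \<le> real W * real (Suc t)"
        by (metis of_nat_le_iff of_nat_mult)
      then show "1 / (real W * real (Suc t)) \<le> 1 / real (g t)"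
        by (rule frac_le[OF _ order_refl, rotated 2]) (simp_all add: g_def add_pos_nonneg)
    qed
    also have "\<dots> = (\<Sum>e\<in>g ` {..<T}. 1 / real e)"
      using inj by (subst sum.reindex) (auto intro: inj_on_subset)
    \<comment> \<open>By injectivity of \<open>g\<close> the factors are distinct divisors of
      \<open>N\<close>, so their reciprocals form part of the divisor sum.\<close>
    also have "\<dots> \<le> (\<Sum>e | e dvd N. 1 / real e)"
      by (rule sum_mono2) (use N in \<open>auto simp: N_def intro: dvd_prodI\<close>)
    finally show ?thesis
      using N by (simp add: divisor_sum_ratio)
  qed
  ultimately show ?thesis by blast
qed

section \<open>Mean value of the ratio along a sequence\<close>

lemma sum_inverse_squares_le:
  "(\<Sum>e=1..n. 1 / real e ^ 2) \<le> 2"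
proof -
  \<comment> \<open>The bound 2 alone does not pass through the induction; subtracting
    \<open>1 / n\<close> makes it telescope.\<close>
  have "(\<Sum>e=1..n. 1 / real e ^ 2) \<le> 2 - 1 / real n" if "n > 0"
    using that
  proof (induction n rule: nat_induct_non_zero)
    case (Suc n)
    have "1 / real (Suc n) ^ 2 \<le> 1 / real n - 1 / real (Suc n)"
      using Suc.hyps by (simp add: divide_simps power2_eq_square)
    with Suc.IH show ?case by simp
  qed simp
  then show ?thesis
    by (cases "n = 0") (auto intro: order_trans)
qed

text \<open>After exchanging the sums, a divisor \<open>e\<close> has weight \<open>1 / e\<close>
  and occurs for at most \<open>a * M / e + 1\<close> indices. The main terms sum to a multiple of
  the inverse squares, the rounding terms to \<open>harm D\<close>. Assumption \<open>dvd\<close>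
  makes indices with a common divisor \<open>e\<close> well spaced, and \<open>a\<close> alone
  governs the spacing.\<close>

lemma sum_divisor_sum_ratio_le:
  fixes f :: "nat \<Rightarrow> nat"
  assumes pos: "\<And>m. m < M \<Longrightarrow> 0 < f m"
    and le: "\<And>m. m < M \<Longrightarrow> f m \<le> D"
    and a: "a > 0"
    and dvd: "\<And>e m m'. m' < m \<Longrightarrow> m < M \<Longrightarrow> e dvd f m \<Longrightarrow> e dvd f m' \<Longrightarrow> e dvd a * (m - m')"
  shows "(\<Sum>m<M. real (divisor_sum (f m)) / real (f m)) \<le> 2 * real a * real M + harm D"
proof -
  have card: "real (card {m. m < M \<and> e dvd f m}) \<le> real a * real M / real e + 1" if e: "e > 0" for e
  proof -
    \<comment> \<open>By \<open>dvd\<close>, \<open>a * m\<close> and \<open>a * m'\<close> leave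
      the same remainder modulo \<open>e\<close>; equal quotients would make them equal. So the
      quotient is injective on the indices counted.\<close>
    have neq: "(a * m') div e \<noteq> (a * m) div e"
      if "m' < m" "m < M" "e dvd f m" "e dvd f m'" for m m'
    proof
      assume eq: "(a * m') div e = (a * m) div e"
      have "(a * m) mod e = (a * m') mod e"
        using dvd[OF that] that(1) by (subst mod_eq_dvd_iff_nat) (auto simp: diff_mult_distrib2)
      with eq have "a * m' = a * m"
        by (metis div_mult_mod_eq)
      with a that(1) show False by simp
    qed
    have "inj_on (\<lambda>m. (a * m) div e) {m. m < M \<and> e dvd f m}"
      by (intro linorder_inj_onI') (use neq in auto)
    then have "card {m. m < M \<and> e dvd f m} \<le> card {..(a * M) div e}"
      by (rule card_inj_on_le) (auto intro!: div_le_mono)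
    then have "real (card {m. m < M \<and> e dvd f m}) \<le> real ((a * M) div e) + 1"
      by simp
    also have "real ((a * M) div e) \<le> real a * real M / real e"
      using of_nat_div_le_of_nat[of "a * M" e] by simp
    finally show ?thesis by simp
  qed
  have "(\<Sum>m<M. real (divisor_sum (f m)) / real (f m)) = (\<Sum>m<M. \<Sum>e | e \<in> {1..D} \<and> e dvd f m. 1 / real e)"
  proof (rule sum.cong)
    fix m assume "m \<in> {..<M}"
    then have m: "0 < f m" "f m \<le> D"
      using pos le by auto
    have "{e. e dvd f m} = {e. e \<in> {1..D} \<and> e dvd f m}"
      using m by (auto dest: dvd_imp_le intro: Nat.gr0I simp: Suc_le_eq)
    then show "real (divisor_sum (f m)) / real (f m) = (\<Sum>e | e \<in> {1..D} \<and> e dvd f m. 1 / real e)"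
      using m by (simp add: divisor_sum_ratio)
  qed simp
  also have "\<dots> = (\<Sum>e=1..D. \<Sum>m | m \<in> {..<M} \<and> e dvd f m. 1 / real e)"
    by (rule sum.swap_restrict) auto
  also have "\<dots> = (\<Sum>e=1..D. real (card {m. m < M \<and> e dvd f m}) / real e)"
    by simp
  also have "\<dots> \<le> (\<Sum>e=1..D. (real a * real M / real e + 1) / real e)"
    by (intro sum_mono divide_right_mono card) auto
  also have "\<dots> = real a * real M * (\<Sum>e=1..D. 1 / real e ^ 2) + harm D"
    by (simp add: harm_def add_divide_distrib sum.distrib sum_distrib_left power2_eq_square inverse_eq_divide)
  also have "\<dots> \<le> real a * real M * 2 + harm D"
    by (intro add_right_mono mult_left_mono sum_inverse_squares_le) auto
  finally show ?thesis by (simp add: mult_ac)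
qed

section \<open>A residue class on which every \<open>H_j\<close> has a rich divisor\<close>

text \<open>The modulus and the residue are enlarged one \<open>j\<close> at a time: the new factor \<open>N\<close> is
  chosen coprime to everything found before, to the coefficients
  \<open>c j\<close> and to the resultants, so the new congruence is solvable and the old ones persist.\<close>

lemma ex_rich_residue_class:
  fixes a b c d :: "nat \<Rightarrow> int" and B :: real
  assumes "finite J" "finite I"
    and "\<And>j. j \<in> J \<Longrightarrow> c j \<noteq> 0"
    and "\<And>i j. i \<in> I \<Longrightarrow> j \<in> J \<Longrightarrow> a i * d j \<noteq> b i * c j"
  shows "\<exists>Q r :: int. Q > 0 \<and>
    (\<forall>j\<in>J. \<exists>N :: nat. int N dvd Q \<and> int N dvd c j * r + d j \<and> B \<le> real (divisor_sum N) / real N) \<and>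
    (\<forall>i\<in>I. coprime Q (a i * r + b i))"
  using assms(1,3,4)
proof (induction J rule: finite_induct)
  case empty
  show ?case by (intro exI[of _ 1]) auto
next
  case (insert j J)
  obtain Q r :: int where Q: "Q > 0"
    and N: "\<And>j. j \<in> J \<Longrightarrow> \<exists>N :: nat. int N dvd Q \<and> int N dvd c j * r + d j \<and> B \<le> real (divisor_sum N) / real N"
    and cop: "\<And>i. i \<in> I \<Longrightarrow> coprime Q (a i * r + b i)"
    using insert.IH[OF insert.prems(1)[OF insertI2] insert.prems(2)[OF _ insertI2]] by blast
  define W where "W = c j * Q * (\<Prod>i\<in>I. a i * d j - b i * c j)"
  have "W \<noteq> 0"
    using Q insert.prems assms(2) by (auto simp: W_def)
  then obtain P :: nat where "coprime P (nat \<bar>W\<bar>)" and P: "P > 0" "B \<le> real (divisor_sum P) / real P"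
    using ex_coprime_divisor_sum_ratio_ge[of "nat \<bar>W\<bar>" B] by auto
  then have PW: "coprime (int P) W"
    by (metis coprime_int_iff coprime_abs_right_iff nat_0_le abs_ge_zero)
  then have "coprime (c j * Q) (int P)"
    by (simp add: W_def coprime_commute)
  then obtain u where u: "[c j * Q * u = 1] (mod int P)"
    using cong_solve_coprime_int by blast
  \<comment> \<open>As \<open>u\<close> inverts \<open>c j * Q\<close> modulo \<open>P\<close>, this
    shift makes \<open>P\<close> divide the new value of \<open>H_j\<close>; being a multiple of
    \<open>Q\<close>, it preserves everything known modulo \<open>Q\<close>.\<close>
  define r' where "r' = r + Q * (- u * (c j * r + d j))"
  have Pr': "int P dvd c j * r' + d j"
  proof -
    have "c j * r' + d j = (c j * r + d j) * (1 - c j * Q * u)"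
      by (simp add: r'_def algebra_simps)
    moreover have "int P dvd 1 - c j * Q * u"
      using u by (simp add: cong_iff_dvd_diff dvd_diff_commute)
    ultimately show ?thesis by simp
  qed
  have shift: "x * r' + y = (x * r + y) + Q * (x * (- u * (c j * r + d j)))" for x y
    by (simp add: r'_def algebra_simps)
  show ?case
  proof (rule exI[of _ "Q * int P"], rule exI[of _ r'], intro conjI ballI)
    show "Q * int P > 0" using Q P by simp
  next
    fix j' assume "j' \<in> insert j J"
    then show "\<exists>N :: nat. int N dvd Q * int P \<and> int N dvd c j' * r' + d j' \<and> B \<le> real (divisor_sum N) / real N"
    proof
      assume "j' = j"
      then show ?thesis using P Pr' by (intro exI[of _ P]) auto
    next
      assume "j' \<in> J"
      then obtain N :: nat where "int N dvd Q" "int N dvd c j' * r + d j'" "B \<le> real (divisor_sum N) / real N"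
        using N by blast
      then show ?thesis unfolding shift
        by (intro exI[of _ N]) auto
    qed
  next
    fix i assume i: "i \<in> I"
    have "coprime Q (a i * r' + b i)"
      unfolding shift using cop[OF i] by (metis coprime_iff_gcd_eq_1 gcd_add_mult mult.commute add.commute)
    moreover have "coprime (int P) (a i * r' + b i)"
    proof (rule coprimeI)
      fix q assume q: "q dvd int P" "q dvd a i * r' + b i"
      \<comment> \<open>This combination eliminates \<open>r'\<close> and leaves the resultant, a
        factor of \<open>W\<close>.\<close>
      have "q dvd a i * (c j * r' + d j) - c j * (a i * r' + b i)"
        using q Pr' by (meson dvd_diff dvd_mult dvd_trans)
      then have "q dvd a i * d j - b i * c j"
        by (simp add: algebra_simps)
      then have "q dvd W"
        unfolding W_def using i assms(2) by (meson dvd_mult dvd_prodI dvd_trans)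
      with PW q(1) show "is_unit q"
        by (meson coprime_common_divisor)
    qed
    ultimately show "coprime (Q * int P) (a i * r' + b i)" by simp
  qed
qed


section \<open>Few large ratios along an arithmetic progression\<close>

lemma eventually_harm_affine_le:
  assumes "p > 0"
  shows "\<forall>\<^sub>F M in sequentially. harm (p * M + q) \<le> real M"
proof -
  have "\<forall>\<^sub>F M in sequentially. ln (real p * real M + real q) + 1 \<le> real M"
    using assms by real_asymp
  then show ?thesis
    using eventually_gt_at_top[of 0]
  proof eventually_elim
    case (elim M)
    have "harm (p * M + q) - ln (real (p * M + q)) \<le> (harm 1 - ln (real 1) :: real)"
      by (rule euler_mascheroni_sequence_decreasing) (use elim assms in \<open>auto simp: Suc_le_eq\<close>)
    then show ?case
      using elim by (simp add: harm_expand)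
  qed
qed

text \<open>Markov's inequality applied to the mean value bound, whose \<open>harm\<close> term is
  eventually at most \<open>M\<close>. All terms are coprime to \<open>Q\<close>, so a common
  divisor of two terms divides their difference with the factor \<open>Q\<close> removed; hence the
  bound does not involve \<open>Q\<close>.\<close>

lemma eventually_card_large_divisor_sum_le:
  fixes A Q :: nat and u K :: int
  assumes "A > 0" "Q > 0" "u > 0" and cop: "coprime (int Q) u" and K: "K > 0"
  shows "\<forall>\<^sub>F M in sequentially.
    real (card {m. m < M \<and> K * int (nat (int A * int Q * int m + u)) < int (divisor_sum (nat (int A * int Q * int m + u)))})
      * real_of_int K \<le> (2 * real A + 1) * real M"
proof -
  define f where "f m = A * Q * m + nat u" for m
  have f: "nat (int A * int Q * int m + u) = f m" for m
    using assms by (simp add: f_def nat_add_distrib nat_mult_distrib)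
  have pos: "f m > 0" for m
    using assms by (simp add: f_def)
  have copf: "coprime (f m) Q" for m
  proof -
    have "coprime (nat u) Q"
      using cop \<open>u > 0\<close> by (metis coprime_commute coprime_int_iff int_nat_eq less_imp_le)
    then show ?thesis
      by (simp add: f_def coprime_iff_gcd_eq_1 gcd.commute[of _ Q])
        (metis gcd_add_mult gcd.commute mult.commute mult.assoc add.commute)
  qed
  have "\<forall>\<^sub>F M in sequentially. harm (A * Q * M + nat u) \<le> real M"
    using assms by (intro eventually_harm_affine_le) simp
  then show ?thesis
    unfolding f
  proof eventually_elim
    case (elim M)
    let ?S = "{m. m < M \<and> K * int (f m) < int (divisor_sum (f m))}"
    have dvd: "e dvd A * (m - m')" if "m' < m" "e dvd f m" "e dvd f m'" for e m m'
    proof -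
      have "e dvd f m - f m'"
        using that by (intro dvd_diff_nat)
      also have "f m - f m' = A * (m - m') * Q"
        by (simp add: f_def diff_mult_distrib2 mult_ac)
      finally show ?thesis
        using copf that(2) by (meson coprime_divisors coprime_dvd_mult_left_iff dvd_refl)
    qed
    have "real (card ?S) * real_of_int K = (\<Sum>m\<in>?S. real_of_int K)"
      by simp
    also have "\<dots> \<le> (\<Sum>m\<in>?S. real (divisor_sum (f m)) / real (f m))"
    proof (rule sum_mono)
      fix m assume "m \<in> ?S"
      then have "real_of_int (K * int (f m)) \<le> real_of_int (int (divisor_sum (f m)))"
        by (simp only: of_int_le_iff) simp
      then show "real_of_int K \<le> real (divisor_sum (f m)) / real (f m)"
        using pos[of m] by (simp add: field_simps)
    qed
    also have "\<dots> \<le> (\<Sum>m<M. real (divisor_sum (f m)) / real (f m))"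
      by (rule sum_mono2) auto
    also have "\<dots> \<le> 2 * real A * real M + harm (A * Q * M + nat u)"
      by (rule sum_divisor_sum_ratio_le)
        (use pos dvd assms(1) in \<open>auto simp: f_def\<close>)
    also have "\<dots> \<le> (2 * real A + 1) * real M"
      using elim by (simp add: algebra_simps)
    finally show ?case .
  qed
qed

section \<open>Choice of constants and counting\<close>

theorem theorem4:
  fixes k :: nat and a b c d :: "nat \<Rightarrow> int"
  assumes "k \<ge> 1"
    and "\<And>i. i \<in> {1..k} \<Longrightarrow> a i > 0"
    and "\<And>j. j \<in> {1..k} \<Longrightarrow> c j > 0"
    and "\<And>i j. i \<in> {1..k} \<Longrightarrow> j \<in> {1..k} \<Longrightarrow> a i * d j \<noteq> b i * c j"
    and "\<And>p :: nat. prime p \<Longrightarrow> \<exists>m :: int. \<forall>i\<in>{1..k}. \<not> int p dvd a i * m + b i"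
  shows "\<exists>C > 0. \<exists>x\<^sub>0 :: real. \<forall>x \<ge> x\<^sub>0.
    C * x / ln x ^ k \<le>
    real (card {n :: nat. 0 < n \<and> real n \<le> x \<and>
      (\<forall>i\<in>{1..k}. a i * int n + b i > 0) \<and>
      (\<forall>j\<in>{1..k}. c j * int n + d j > 0) \<and>
      (\<forall>j\<in>{1..k}. divisor_sum (nat (c j * int n + d j)) >
         Max ((\<lambda>i. divisor_sum (nat (a i * int n + b i))) ` {1..k}))})"
proof -
  let ?I = "{1..k}"
  define A where "A = (\<Sum>i\<in>?I. a i)"
  \<comment> \<open>Beyond \<open>n\<^sub>0\<close> the constant terms are dominated:
    \<open>L_i(n)\<close> lies between 1 and \<open>(A + 1) * n\<close>, and \<open>H_j(n)\<close>
    exceeds \<open>n / 2\<close>.\<close>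
  define n\<^sub>0 where "n\<^sub>0 = 1 + (\<Sum>i\<in>?I. \<bar>b i\<bar>) + (\<Sum>j\<in>?I. 2 * \<bar>d j\<bar>)"
  \<comment> \<open>Each bad set then has at most \<open>(2 * A + 1) * M / K = M / (2 * k)\<close>
    elements, so all \<open>k\<close> together remove at most half of the indices.\<close>
  define K where "K = 2 * int k * (2 * A + 1)"
  \<comment> \<open>On good indices the divisor sum of \<open>L_i\<close> is at most
    \<open>K * (A + 1) * n\<close>, hence at most \<open>2 * K * (A + 1)\<close> times
    \<open>H_j\<close>; the extra 1 makes the comparison strict.\<close>
  define B where "B = real_of_int (K * (2 * (A + 1))) + 1"
  have aA: "a i \<le> A" if "i \<in> ?I" for i
    unfolding A_def using that assms(2) by (intro member_le_sum) (auto intro: less_imp_le)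
  have A: "A > 0"
    using aA[of 1] assms(2)[of 1] assms(1) by force
  have K: "K > 0"
    using A assms(1) by (simp add: K_def)
  have bn0: "\<bar>b i\<bar> < n\<^sub>0" if "i \<in> ?I" for i
    using member_le_sum[OF that, of "\<lambda>i. \<bar>b i\<bar>"] sum_nonneg[of ?I "\<lambda>j. 2 * \<bar>d j\<bar>"]
    by (simp add: n\<^sub>0_def)
  have dn0: "2 * \<bar>d i\<bar> < n\<^sub>0" if "i \<in> ?I" for i
  proof -
    have "(\<Sum>i\<in>?I. \<bar>b i\<bar>) \<ge> 0" by (rule sum_nonneg) simp
    moreover have "2 * \<bar>d i\<bar> \<le> (\<Sum>j\<in>?I. 2 * \<bar>d j\<bar>)"
      using that by (rule member_le_sum) auto
    ultimately show ?thesis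
      unfolding n\<^sub>0_def by linarith
  qed
  have n0: "n\<^sub>0 > 0"
    using bn0[of 1] assms(1) by force
  have L_pos: "a i * n + b i > 0" and L_le: "a i * n + b i \<le> (A + 1) * n"
    if "i \<in> ?I" "n \<ge> n\<^sub>0" for i n
  proof -
    have "1 * n \<le> a i * n" "a i * n \<le> A * n"
      using that n0 assms(2)[of i] aA[of i] by (auto intro!: mult_right_mono)
    then show "a i * n + b i > 0" "a i * n + b i \<le> (A + 1) * n"
      using bn0[OF that(1)] that(2) by (auto simp: algebra_simps)
  qed
  have H_ge: "n < 2 * (c j * n + d j)" and H_pos: "c j * n + d j > 0" if "j \<in> ?I" "n > n\<^sub>0" for j n
  proof -
    have "1 * n \<le> c j * n"
      using that n0 assms(3)[of j] by (intro mult_right_mono) auto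
    then show "n < 2 * (c j * n + d j)" "c j * n + d j > 0"
      using dn0[OF that(1)] that(2) by (auto simp: algebra_simps)
  qed
  obtain Q r :: int where Q: "Q > 0"
    and N: "\<And>j. j \<in> ?I \<Longrightarrow> \<exists>N :: nat. int N dvd Q \<and> int N dvd c j * r + d j \<and> B \<le> real (divisor_sum N) / real N"
    and cop: "\<And>i. i \<in> ?I \<Longrightarrow> coprime Q (a i * r + b i)"
  proof -
    have "c j \<noteq> 0" if "j \<in> ?I" for j
      using assms(3)[OF that] by simp
    from ex_rich_residue_class[of ?I ?I c a d b B, OF finite_atLeastAtMost finite_atLeastAtMost this assms(4)]
    show thesis
      using that by blast
  qed
  \<comment> \<open>A representative of \<open>r\<close> modulo \<open>Q\<close> above
    \<open>n\<^sub>0\<close>, so that the size estimates hold along the whole progression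
    \<open>g\<close>.\<close>
  define s where "s = r mod Q + Q * (n\<^sub>0 + 1)"
  have "s > n\<^sub>0"
  proof -
    have "1 * (n\<^sub>0 + 1) \<le> Q * (n\<^sub>0 + 1)"
      using Q n0 by (intro mult_right_mono) auto
    moreover have "r mod Q \<ge> 0" using Q by simp
    ultimately show ?thesis by (simp add: s_def)
  qed
  have s: "\<exists>t. s = r + Q * t"
    by (rule exI[of _ "n\<^sub>0 + 1 - r div Q"])
      (simp add: s_def algebra_simps minus_mult_div_eq_mod [symmetric])
  define g where "g m = nat (s + Q * int m)" for m
  have g: "int (g m) = s + Q * int m" for m
    using \<open>s > n\<^sub>0\<close> n0 Q by (simp add: g_def)
  have g_gt: "int (g m) > n\<^sub>0" for m
    unfolding g using \<open>s > n\<^sub>0\<close> Q by (simp add: add_pos_nonneg less_le_trans)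
  have g_inj: "inj g"
  proof (rule injI)
    fix m m' assume "g m = g m'"
    then have "s + Q * int m = s + Q * int m'" using g by metis
    then show "m = m'" using Q by simp
  qed
  define l where "l i m = nat (a i * int (g m) + b i)" for i m
  define h where "h j m = nat (c j * int (g m) + d j)" for j m
  define bad where "bad i M = {m. m < M \<and> K * int (l i m) < int (divisor_sum (l i m))}" for i M
  define good where "good M = {..<M} - (\<Union>i\<in>?I. bad i M)" for M

  have H_large: "real (h j m) * B \<le> real (divisor_sum (h j m))" if j: "j \<in> ?I" for j m
  proof -
    obtain N :: nat where N': "int N dvd Q" "int N dvd c j * r + d j" "B \<le> real (divisor_sum N) / real N"
      using N[OF j] by blast
    obtain t where t: "s = r + Q * t" using s by blast
    have "int N dvd (c j * r + d j) + Q * (c j * (t + int m))"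
      by (rule dvd_add[OF N'(2) dvd_mult2[OF N'(1)]])
    also have "(c j * r + d j) + Q * (c j * (t + int m)) = c j * int (g m) + d j"
      by (simp add: g t algebra_simps)
    finally have "int N dvd c j * int (g m) + d j" .
    moreover have pos: "c j * int (g m) + d j > 0"
      using H_pos[OF j g_gt] .
    ultimately have "N dvd h j m" "h j m > 0"
      by (simp_all add: h_def flip: of_nat_dvd_iff[where ?'a = int])
    moreover from this N'(3) have "B \<le> real (divisor_sum (h j m)) / real (h j m)"
      by (meson divisor_sum_ratio_mono order_trans)
    ultimately show ?thesis
      by (simp add: field_simps)
  qed

  have good_imp: "divisor_sum (l i m) < divisor_sum (h j m)"
    if m: "m \<in> good M" and i: "i \<in> ?I" and j: "j \<in> ?I" for m M i j
  proof -
    have "h j m > 0"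
      using H_pos[OF j g_gt] by (simp add: h_def)
    have "int (divisor_sum (l i m)) \<le> K * int (l i m)"
      using m i by (auto simp: good_def bad_def not_less)
    also have "\<dots> \<le> K * ((A + 1) * int (g m))"
      using L_pos[OF i less_imp_le[OF g_gt]] L_le[OF i less_imp_le[OF g_gt]] K
      by (intro mult_left_mono) (auto simp: l_def less_imp_le)
    also have "\<dots> \<le> K * ((A + 1) * (2 * int (h j m)))"
      using H_ge[OF j g_gt, of m] K A by (intro mult_left_mono) (auto simp: h_def)
    finally have "real (divisor_sum (l i m)) \<le> real_of_int (K * ((A + 1) * (2 * int (h j m))))"
      by (metis of_int_le_iff of_int_of_nat_eq)
    also have "\<dots> < real (h j m) * B"
      using \<open>h j m > 0\<close> by (simp add: B_def algebra_simps)
    also note H_large[OF j]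
    finally show ?thesis by simp
  qed

  have "\<forall>\<^sub>F M in sequentially. real (card (bad i M)) * real_of_int K \<le> (2 * real_of_int A + 1) * real M"
    if i: "i \<in> ?I" for i
  proof -
    have l: "l i m = nat (int (nat (a i)) * int (nat Q) * int m + (a i * s + b i))" for m
      using assms(2)[OF i] Q by (simp add: l_def g algebra_simps)
    have u: "a i * s + b i > 0"
      using L_pos[OF i] \<open>s > n\<^sub>0\<close> by simp
    obtain t where t: "s = r + Q * t" using s by blast
    have "a i * s + b i = (a i * r + b i) + Q * (a i * t)"
      by (simp add: t algebra_simps)
    then have "coprime Q (a i * s + b i)"
      using cop[OF i] by (metis coprime_iff_gcd_eq_1 gcd_add_mult mult.commute add.commute)
    then have "\<forall>\<^sub>F M in sequentially. real (card (bad i M)) * real_of_int K \<le> (2 * real (nat (a i)) + 1) * real M"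
      unfolding bad_def l using assms(2)[OF i] Q u K by (intro eventually_card_large_divisor_sum_le) auto
    then show ?thesis
    proof eventually_elim
      case (elim M)
      also have "(2 * real (nat (a i)) + 1) * real M \<le> (2 * real_of_int A + 1) * real M"
        using aA[OF i] assms(2)[OF i] by (intro mult_right_mono) auto
      finally show ?case .
    qed
  qed
  then have "\<forall>\<^sub>F M in sequentially. \<forall>i\<in>?I. real (card (bad i M)) * real_of_int K \<le> (2 * real_of_int A + 1) * real M"
    by (simp add: eventually_ball_finite)
  then obtain M\<^sub>0 where M0: "\<And>M i. M \<ge> M\<^sub>0 \<Longrightarrow> i \<in> ?I \<Longrightarrow>
      real (card (bad i M)) * real_of_int K \<le> (2 * real_of_int A + 1) * real M"
    unfolding eventually_sequentially by blast
  have good_card: "real M \<le> 2 * real (card (good M))" if "M \<ge> M\<^sub>0" for M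
  proof -
    have "2 * real k * real (card (bad i M)) \<le> real M" if "i \<in> ?I" for i
    proof -
      have "(2 * real_of_int A + 1) * (2 * real k * real (card (bad i M))) \<le> (2 * real_of_int A + 1) * real M"
        using M0[OF \<open>M \<ge> M\<^sub>0\<close> that] by (simp add: K_def algebra_simps)
      then show ?thesis
        using A by (simp add: mult_le_cancel_left)
    qed
    then have "(\<Sum>i\<in>?I. 2 * real k * real (card (bad i M))) \<le> (\<Sum>i\<in>?I. real M)"
      by (rule sum_mono)
    then have "real k * (2 * (\<Sum>i\<in>?I. real (card (bad i M)))) \<le> real k * real M"
      by (simp add: sum_distrib_left mult_ac)
    then have "2 * (\<Sum>i\<in>?I. real (card (bad i M))) \<le> real M"
      using assms(1) by simp
    moreover have "card (\<Union>i\<in>?I. bad i M) \<le> (\<Sum>i\<in>?I. card (bad i M))"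
      by (rule card_UN_le) simp
    moreover have "card (good M) = M - card (\<Union>i\<in>?I. bad i M)"
      unfolding good_def by (subst card_Diff_subset) (auto simp: bad_def)
    ultimately show ?thesis
      by (simp flip: of_nat_sum)
  qed

  \<comment> \<open>At least \<open>x / (2 * Q)\<close> indices are available and at least half of
    them are good.\<close>
  define C where "C = 1 / (4 * real_of_int Q)"
  \<comment> \<open>In order, the three bounds ensure \<open>ln x \<ge> 1\<close>,
    \<open>(x - s) / Q - 1 \<ge> x / (2 * Q)\<close>, and \<open>M \<ge> M\<^sub>0\<close>.\<close>
  define x\<^sub>0 where "x\<^sub>0 = max 3 (max (2 * real_of_int (s + Q)) (2 * real_of_int Q * real M\<^sub>0))"
  show ?thesis
  proof (rule exI[of _ C], rule conjI[rotated], rule exI[of _ x\<^sub>0], intro allI impI)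
    show "C > 0" using Q by (simp add: C_def)
  next
    fix x assume x: "x \<ge> x\<^sub>0"
    let ?G = "{n :: nat. 0 < n \<and> real n \<le> x \<and>
      (\<forall>i\<in>?I. a i * int n + b i > 0) \<and>
      (\<forall>j\<in>?I. c j * int n + d j > 0) \<and>
      (\<forall>j\<in>?I. divisor_sum (nat (c j * int n + d j)) >
         Max ((\<lambda>i. divisor_sum (nat (a i * int n + b i))) ` ?I))}"
    have x3: "x \<ge> 3" and xQ: "x \<ge> 2 * real_of_int (s + Q)" and xM: "x \<ge> 2 * real_of_int Q * real M\<^sub>0"
      using x by (auto simp: x\<^sub>0_def)
    define M where "M = nat \<lfloor>(x - real_of_int s) / real_of_int Q\<rfloor>"
    have s_pos: "s > 0" using \<open>s > n\<^sub>0\<close> n0 by simp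
    have quot_nonneg: "(x - real_of_int s) / real_of_int Q \<ge> 0"
      using xQ Q s_pos by (intro divide_nonneg_pos) auto
    then have M_le: "real M \<le> (x - real_of_int s) / real_of_int Q"
      and M_ge: "(x - real_of_int s) / real_of_int Q - 1 \<le> real M"
      unfolding M_def by linarith+
    have "x / (2 * real_of_int Q) \<le> (x - real_of_int s) / real_of_int Q - 1"
      using xQ Q by (simp add: field_simps)
    with M_ge have xM': "x / (2 * real_of_int Q) \<le> real M" by simp
    moreover have "real M\<^sub>0 \<le> x / (2 * real_of_int Q)"
      using xM Q by (simp add: field_simps)
    ultimately have "M \<ge> M\<^sub>0" by linarith
    have "ln x \<ge> 1"
      using x3 exp_le by (subst ln_ge_iff) auto
    \<comment> \<open>The linear lower bound \<open>C * x\<close> therefore implies the one with the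
      logarithmic factor.\<close>
    then have "ln x ^ k \<ge> 1" by simp
    then have "C * x / ln x ^ k \<le> C * x / 1"
      using x3 Q by (intro divide_left_mono) (auto simp: C_def)
    also have "\<dots> \<le> real M / 2"
      using xM' by (simp add: C_def)
    also have "\<dots> \<le> real (card (good M))"
      using good_card[OF \<open>M \<ge> M\<^sub>0\<close>] by simp
    also have "card (good M) = card (g ` good M)"
      using g_inj by (metis card_image inj_on_subset subset_UNIV)
    also have "real (card (g ` good M)) \<le> real (card ?G)"
    proof (intro of_nat_mono card_mono)
      show "finite ?G"
        by (rule finite_subset[of _ "{..nat \<lfloor>x\<rfloor>}"]) (auto simp: le_nat_floor)
      show "g ` good M \<subseteq> ?G"
      proof (intro image_subsetI CollectI conjI ballI)
        fix m assume m: "m \<in> good M"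
        show "0 < g m" using g_gt[of m] n0 by linarith
        have "real m \<le> real M" using m by (simp add: good_def)
        then have "real m \<le> (x - real_of_int s) / real_of_int Q"
          using M_le by linarith
        then have "real_of_int Q * real m \<le> x - real_of_int s"
          using Q by (simp add: pos_le_divide_eq mult.commute)
        moreover have "real (g m) = real_of_int s + real_of_int Q * real m"
          using g[of m] by (metis of_int_add of_int_mult of_int_of_nat_eq)
        ultimately show "real (g m) \<le> x" by simp
        show "a i * int (g m) + b i > 0" if "i \<in> ?I" for i
          using L_pos[OF that] g_gt[of m] by simp
        show "c j * int (g m) + d j > 0" if "j \<in> ?I" for j
          using H_pos[OF that g_gt] .
        show "divisor_sum (nat (c j * int (g m) + d j)) >
            Max ((\<lambda>i. divisor_sum (nat (a i * int (g m) + b i))) ` ?I)" if "j \<in> ?I" for j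
          using good_imp[OF m _ that] assms(1) by (subst Max_less_iff) (auto simp: l_def h_def)
      qed
    qed
    finally show "C * x / ln x ^ k \<le> real (card ?G)" .
  qed
qed

end
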